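(* For every nonzero $C^*$-algebra $A$, the standard Hilbert $A$-module $V=l_2(A)$ does not have the module Schur property.
   Context: Hilbert modules are right Hilbert $C^*$-modules, with $A$-valued inner product $\langle\cdot,\cdot\rangle$ that is $A$-linear in the second variable. The standard module $l_2(A)$ consists of all sequences $(a_i)_{i\in\mathbb N}$ in $A$ such that $\sum_{i=1}^\infty a_i^*a_i$ converges in norm, with inner product $\langle (a_i),(b_i)\rangle=\sum_i a_i^*b_i$. For a Hilbert $A$-module $V$, the topology $\tau_{\widehat V}$ on $V$ is the locally convex topology generated by the seminorms $x\mapsto\|\langle z,x\rangle\|$, $z\in V$. A sequence $\{x_n\}$ in $V$ is called $\tau_{\widehat V}$-convergent if for every $z\in V$ the sequence $\{\langle z,x_n\rangle\}$ converges in norm in $A$ (so the limit may lie in the completion of $V$ with respect to $\tau_{\widehat V}$, not necessarily in $V$). $V$ has the module Schur property if every $\tau_{\widehat V}$-convergent sequence in $V$ converges in norm (to an element of $V$). *)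

theory Defs
  imports "HOL-Analysis.Analysis" "HOL-Library.Function_Algebras"
begin

(* Not necessarily unital.  That 1 acts as the identity follows from scaleR_scaleC. *)
class cstar_algebra = real_normed_algebra + banach +
  fixes scaleC :: "complex \<Rightarrow> 'a \<Rightarrow> 'a" (infixr \<open>*\<^sub>C\<close> 75)
    and adj :: "'a \<Rightarrow> 'a"
  assumes scaleC_add_right: "c *\<^sub>C (x + y) = c *\<^sub>C x + c *\<^sub>C y"
    and scaleC_add_left: "(c + d) *\<^sub>C x = c *\<^sub>C x + d *\<^sub>C x"
    and scaleC_scaleC: "c *\<^sub>C (d *\<^sub>C x) = (c * d) *\<^sub>C x"
    and scaleR_scaleC: "r *\<^sub>R x = complex_of_real r *\<^sub>C x"
    and mult_scaleC_left: "(c *\<^sub>C x) * y = c *\<^sub>C (x * y)"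
    and mult_scaleC_right: "x * (c *\<^sub>C y) = c *\<^sub>C (x * y)"
    and norm_scaleC: "norm (c *\<^sub>C x) = cmod c * norm x"
    and adj_adj: "adj (adj x) = x"
    and adj_add: "adj (x + y) = adj x + adj y"
    and adj_scaleC: "adj (c *\<^sub>C x) = cnj c *\<^sub>C adj x"
    and adj_mult: "adj (x * y) = adj y * adj x"
    and cstar_identity: "norm (adj x * x) = (norm x)\<^sup>2"

(* In the following definitions a Hilbert A-module is represented by its carrier V, a subset of an
   ambient abelian group, and its A-valued inner product ip. *)

definition hilbert_norm :: "('v \<Rightarrow> 'v \<Rightarrow> 'a::cstar_algebra) \<Rightarrow> 'v \<Rightarrow> real"
  where "hilbert_norm ip x = sqrt (norm (ip x x))"

(* The limits of the sequences ip z (X n) need not be of the form ip z x with x in V. *)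
definition tau_convergent ::
    "'v set \<Rightarrow> ('v \<Rightarrow> 'v \<Rightarrow> 'a::cstar_algebra) \<Rightarrow> (nat \<Rightarrow> 'v) \<Rightarrow> bool"
  where "tau_convergent V ip X \<longleftrightarrow> (\<forall>z\<in>V. convergent (\<lambda>n. ip z (X n)))"

definition norm_convergent ::
    "'v::ab_group_add set \<Rightarrow> ('v \<Rightarrow> 'v \<Rightarrow> 'a::cstar_algebra) \<Rightarrow> (nat \<Rightarrow> 'v) \<Rightarrow> bool"
  where "norm_convergent V ip X \<longleftrightarrow> (\<exists>x\<in>V. (\<lambda>n. hilbert_norm ip (X n - x)) \<longlonglongrightarrow> 0)"

definition module_schur_property ::
    "'v::ab_group_add set \<Rightarrow> ('v \<Rightarrow> 'v \<Rightarrow> 'a::cstar_algebra) \<Rightarrow> bool"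
  where "module_schur_property V ip \<longleftrightarrow>
    (\<forall>X. (\<forall>n. X n \<in> V) \<and> tau_convergent V ip X \<longrightarrow> norm_convergent V ip X)"

definition l2_carrier :: "(nat \<Rightarrow> 'a::cstar_algebra) set"
  where "l2_carrier = {a. summable (\<lambda>i. adj (a i) * a i)}"

(* For a, b in l2_carrier the series converges in norm by the Cauchy-Schwarz inequality;
   the value of suminf outside l2_carrier is irrelevant. *)
definition l2_inner :: "(nat \<Rightarrow> 'a::cstar_algebra) \<Rightarrow> (nat \<Rightarrow> 'a) \<Rightarrow> 'a"
  where "l2_inner a b = (\<Sum>i. adj (a i) * b i)"

end

theory Submission
  imports Defs
begin

text \<open>Fix a nonzero element a and let X be the sequence that is a times the nth basis vector for
  even n and 0 for odd n. Inner products with a fixed z tend to 0 because the entries of z do.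
  If X converged in norm to x, then the inner product of x with itself would be 0 (odd n), while
  the even n would give the value minus the adjoint of a times a, since the entries of x tend to 0.
  Interleaving with 0 makes the order on positive elements unnecessary.\<close>

text \<open>The C*-identity and submultiplicativity bound the square of \<open>norm x\<close> by
  \<open>norm (adj x) * norm x\<close>, and a factor cancels. Applying this also to
  \<open>adj x\<close> makes \<open>adj\<close> isometric.\<close>

lemma norm_adj_le: "norm x \<le> norm (adj x)" for x :: "'a::cstar_algebra"
proof (cases "x = 0")
  case False
  have "norm x * norm x \<le> norm (adj x) * norm x"
    using norm_mult_ineq[of "adj x" x] by (simp add: cstar_identity power2_eq_square)
  then show ?thesis using False by simp
qed simp

lemma norm_adj: "norm (adj x) = norm x" for x :: "'a::cstar_algebra"
  using norm_adj_le[of x] norm_adj_le[of "adj x"] by (simp add: adj_adj)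

text \<open>Real scalars are fixed by \<open>cnj\<close>, so the conjugate-linear \<open>adj\<close>
  is real-linear. This supplies its continuity.\<close>

lemma bounded_linear_adj: "bounded_linear (adj :: 'a::cstar_algebra \<Rightarrow> 'a)"
  by (rule bounded_linear_intro[where K = 1])
    (simp_all add: adj_add scaleR_scaleC adj_scaleC norm_adj)

lemmas adj_minus = linear_neg[OF bounded_linear.linear[OF bounded_linear_adj]]
lemmas tendsto_adj = bounded_linear.tendsto[OF bounded_linear_adj]

text \<open>The terms of a convergent series tend to 0, and by the C*-identity their norms are the
  squares of the norms of the entries.\<close>

lemma l2_carrier_tendsto_zero:
  assumes "x \<in> l2_carrier"
  shows "x \<longlonglongrightarrow> 0"
proof -
  have "(\<lambda>i. adj (x i) * x i) \<longlonglongrightarrow> 0"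
    using assms by (auto simp: l2_carrier_def intro: summable_LIMSEQ_zero)
  then have "(\<lambda>i. sqrt (norm (adj (x i) * x i))) \<longlonglongrightarrow> 0"
    using tendsto_real_sqrt[OF tendsto_norm_zero] by (metis real_sqrt_zero)
  then show ?thesis by (simp add: cstar_identity tendsto_norm_zero_iff)
qed

definition l2_single :: "nat \<Rightarrow> 'a::cstar_algebra \<Rightarrow> nat \<Rightarrow> 'a"
  where "l2_single n a = (\<lambda>i. if i = n then a else 0)"

lemma l2_single_in_carrier: "l2_single n a \<in> l2_carrier"
proof -
  have "(\<lambda>i. adj (l2_single n a i) * l2_single n a i) = (\<lambda>i. if i = n then adj a * a else 0)"
    by (auto simp: l2_single_def)
  then show ?thesis by (simp add: l2_carrier_def)
qed

lemma l2_inner_single: "l2_inner z (l2_single n a) = adj (z n) * a"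
proof -
  have "(\<lambda>i. adj (z i) * l2_single n a i) = (\<lambda>i. if i = n then adj (z n) * a else 0)"
    by (auto simp: l2_single_def)
  then show ?thesis
    using sums_unique[OF sums_single[of n "\<lambda>_. adj (z n) * a"]] by (simp add: l2_inner_def)
qed

text \<open>Away from index \<open>n\<close> the entry is \<open>- x i\<close>, whose two signs
  cancel, so the series differs from that of \<open>x\<close> in one term only.\<close>

lemma l2_inner_single_diff:
  assumes "x \<in> l2_carrier"
  shows "l2_inner (l2_single n a - x) (l2_single n a - x) =
    l2_inner x x + (adj (a - x n) * (a - x n) - adj (x n) * x n)"
proof -
  let ?c = "adj (a - x n) * (a - x n) - adj (x n) * x n"
  have "(\<lambda>i. adj (x i) * x i) sums l2_inner x x"
    using assms by (simp add: l2_carrier_def l2_inner_def summable_sums)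
  then have "(\<lambda>i. adj (x i) * x i + (if i = n then ?c else 0)) sums (l2_inner x x + ?c)"
    by (intro sums_add sums_single)
  moreover have "(\<lambda>i. adj (x i) * x i + (if i = n then ?c else 0)) =
      (\<lambda>i. adj ((l2_single n a - x) i) * (l2_single n a - x) i)"
    by (auto simp: l2_single_def adj_minus)
  ultimately show ?thesis
    by (simp add: l2_inner_def sums_iff)
qed

text \<open>A Pythagorean identity in the limit: as the single entry moves out to infinity, its
  overlap with \<open>x\<close> vanishes.\<close>

lemma l2_inner_single_diff_tendsto:
  assumes x: "x \<in> l2_carrier"
  shows "(\<lambda>n. l2_inner (l2_single n a - x) (l2_single n a - x))
    \<longlonglongrightarrow> l2_inner x x + adj a * a"
proof -
  have "(\<lambda>n. l2_inner x x + (adj (a - x n) * (a - x n) - adj (x n) * x n))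
      \<longlonglongrightarrow> l2_inner x x + (adj (a - 0) * (a - 0) - adj 0 * 0)"
    by (intro tendsto_intros tendsto_adj l2_carrier_tendsto_zero[OF x])
  then show ?thesis by (simp add: l2_inner_single_diff[OF x])
qed

theorem proposition4p11:
  assumes nonzero: "\<exists>a::'a::cstar_algebra. a \<noteq> 0"
  shows "\<not> module_schur_property
           (l2_carrier :: (nat \<Rightarrow> 'a) set) (l2_inner :: (nat \<Rightarrow> 'a) \<Rightarrow> (nat \<Rightarrow> 'a) \<Rightarrow> 'a)"
proof
  assume schur: "module_schur_property (l2_carrier :: (nat \<Rightarrow> 'a) set) l2_inner"
  obtain a :: 'a where a: "a \<noteq> 0" using nonzero by blast
  define b where "b n = (if even n then a else 0)" for n :: nat
  define X where "X n = l2_single n (b n)" for n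
  have "(\<lambda>n. l2_inner z (X n)) \<longlonglongrightarrow> 0" if z: "z \<in> l2_carrier" for z
  proof (rule Lim_null_comparison)
    show "\<forall>\<^sub>F n in sequentially. norm (l2_inner z (X n)) \<le> norm (z n) * norm a"
    proof (rule always_eventually, rule allI)
      fix n
      \<comment> \<open>For odd \<open>n\<close> the left side is 0, so one bound serves both
        parities.\<close>
      show "norm (l2_inner z (X n)) \<le> norm (z n) * norm a"
        using norm_mult_ineq[of "adj (z n)" a]
        by (simp add: X_def b_def l2_inner_single norm_adj)
    qed
    show "(\<lambda>n. norm (z n) * norm a) \<longlonglongrightarrow> 0"
      by (intro tendsto_mult_left_zero tendsto_norm_zero l2_carrier_tendsto_zero z)
  qed
  then have "tau_convergent l2_carrier l2_inner X"
    unfolding tau_convergent_def convergent_def by blast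
  moreover have "\<forall>n. X n \<in> l2_carrier"
    by (simp add: X_def l2_single_in_carrier)
  ultimately obtain x where x: "x \<in> l2_carrier"
    and "(\<lambda>n. hilbert_norm l2_inner (X n - x)) \<longlonglongrightarrow> 0"
    using schur unfolding module_schur_property_def norm_convergent_def by blast
  \<comment> \<open>Squaring removes the square root in \<open>hilbert_norm\<close>.\<close>
  then have "(\<lambda>n. (hilbert_norm l2_inner (X n - x))\<^sup>2) \<longlonglongrightarrow> 0\<^sup>2"
    by (intro tendsto_power)
  then have lim: "(\<lambda>n. l2_inner (X n - x) (X n - x)) \<longlonglongrightarrow> 0"
    by (simp add: hilbert_norm_def tendsto_norm_zero_iff)
  \<comment> \<open>Along indices where \<open>b\<close> has the constant value \<open>c\<close>,
    the limit computed for a fixed entry must agree with the limit 0 forced by norm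
    convergence.\<close>
  have "l2_inner x x + adj c * c = 0"
    if r: "strict_mono r" "\<And>n. b (r n) = c" for r :: "nat \<Rightarrow> nat" and c
  proof (rule LIMSEQ_unique)
    show "(\<lambda>n. l2_inner (X (r n) - x) (X (r n) - x)) \<longlonglongrightarrow> 0"
      using LIMSEQ_subseq_LIMSEQ[OF lim r(1)] by (simp add: o_def)
    show "(\<lambda>n. l2_inner (X (r n) - x) (X (r n) - x)) \<longlonglongrightarrow> l2_inner x x + adj c * c"
      using LIMSEQ_subseq_LIMSEQ[OF l2_inner_single_diff_tendsto[OF x] r(1)] r(2)
      by (simp add: o_def X_def)
  qed
  \<comment> \<open>The odd indices give \<open>l2_inner x x = 0\<close>, which is then substituted
    into the equation from the even ones.\<close>
  from this[of "\<lambda>n. 2 * n" a] this[of "\<lambda>n. 2 * n + 1" 0]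
  have "adj a * a = 0" by (simp add: strict_mono_def b_def)
  then show False using cstar_identity[of a] a by simp
qed

end
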